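(* Let $A\in 1+x\mathbb{C}[[x]]$. For $\tau\in[0,1]$ put $$F(\tau)=\frac{1}{A\circ (xA^\tau)^{\langle -1\rangle}}\in 1+x\mathbb{C}[[x]] .$$ Then $\tau\mapsto F(\tau)$ is a continuous deformation (a continuous path in $1+x\mathbb{C}[[x]]$) linking the multiplicative inverse of $A$ to the compositional inverse of $xA$, where $1+x\mathbb{C}[[x]]$ is identified with $x+x^2\mathbb{C}[[x]]$ via $B\mapsto xB$; that is, $F(0)=\frac1A$ and $$x\,F(1)=\frac{x}{A\circ (xA)^{\langle -1\rangle}}=(xA)^{\langle -1\rangle}.$$
   Context: For $A\in 1+x\mathbb{C}[[x]]$ and $\tau\in\mathbb{C}$, $A^\tau=e^{\tau\log A}\in 1+x\mathbb{C}[[x]]$, where $\log A$ is the formal logarithm with zero constant term. For $\alpha\in\mathbb{C}[[x]]$ with zero constant term and nonzero linear coefficient, $\alpha^{\langle -1\rangle}$ denotes its compositional inverse: $\alpha\circ\alpha^{\langle -1\rangle}=\alpha^{\langle -1\rangle}\circ\alpha=x$. The set $\mathbb{C}[[x]]$ carries the topology of coefficientwise convergence. *)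

theory Defs
  imports
    "HOL-Analysis.Analysis"
    "HOL-Computational_Algebra.Formal_Power_Series"
begin

unbundle fps_syntax

(* fps_ln 1 is the series log (1 + x), so this is the formal logarithm of A for A $ 0 = 1;
   its constant term is zero.  The value is junk if A $ 0 is not 1. *)
definition fps_log :: "complex fps \<Rightarrow> complex fps" where
  "fps_log A = fps_ln 1 oo (A - 1)"

(* fps_exp 1 is the series e^x. *)
definition fps_cpow :: "complex fps \<Rightarrow> complex \<Rightarrow> complex fps" where
  "fps_cpow A \<tau> = fps_exp 1 oo (fps_const \<tau> * fps_log A)"

(* The type class topology on fps is the x-adic one (discrete coefficients), in which the path of
   the theorem is not continuous in general.  Coefficientwise convergence, with the usual
   topology of the complex numbers in each coefficient, has to be introduced separately. *)
definition fps_coeff_topology :: "complex fps topology" where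
  "fps_coeff_topology =
     pullback_topology UNIV fps_nth (product_topology (\<lambda>_. euclidean) UNIV)"

definition fps_one_plus :: "complex fps set" where
  "fps_one_plus = {B. B $ 0 = 1}"

lemma continuous_map_fps_coeff_topology:
  "continuous_map X fps_coeff_topology f \<longleftrightarrow> (\<forall>n. continuous_map X euclidean (\<lambda>x. f x $ n))"
proof -
  have "continuous_map X fps_coeff_topology f \<longleftrightarrow>
        continuous_map X (product_topology (\<lambda>_::nat. euclidean :: complex topology) UNIV) (fps_nth \<circ> f)"
  proof
    assume "continuous_map X fps_coeff_topology f"
    moreover have "continuous_map fps_coeff_topology
        (product_topology (\<lambda>_::nat. euclidean :: complex topology) UNIV) fps_nth"
      using continuous_map_pullback[OF continuous_map_id, of UNIV fps_nth]
      by (simp add: fps_coeff_topology_def)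
    ultimately show "continuous_map X (product_topology (\<lambda>_. euclidean) UNIV) (fps_nth \<circ> f)"
      by (rule continuous_map_compose)
  next
    assume "continuous_map X (product_topology (\<lambda>_. euclidean) UNIV) (fps_nth \<circ> f)"
    then show "continuous_map X fps_coeff_topology f"
      unfolding fps_coeff_topology_def by (rule continuous_map_pullback') simp
  qed
  then show ?thesis
    by (simp add: continuous_map_componentwise_UNIV)
qed

end

(* Every coefficient of F(\<tau>) depends continuously on \<tau>, because each coefficient of a
   product, a composition or a compositional inverse is a rational expression in finitely many
   coefficients of the arguments; the denominators that occur are powers of the linear coefficient
   of x A^\<tau>, which is 1.  Writing 1 / (A o g) as (1 / A) o g keeps the multiplicative inverse
   out of the continuity argument.  The value at \<tau> = 1 comes from composing x A with its
   compositional inverse g, which gives g (A o g) = x. *)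
theory Submission
  imports Defs
begin

lemma continuous_on_fps_nth_mult:
  fixes f g :: "'a::topological_space \<Rightarrow> 'b::real_normed_algebra fps"
  assumes "\<And>n. continuous_on S (\<lambda>t. f t $ n)" "\<And>n. continuous_on S (\<lambda>t. g t $ n)"
  shows "continuous_on S (\<lambda>t. (f t * g t) $ n)"
  unfolding fps_mult_nth by (intro continuous_intros assms)

lemma continuous_on_fps_nth_power:
  fixes f :: "'a::topological_space \<Rightarrow> 'b::real_normed_algebra_1 fps"
  assumes "\<And>n. continuous_on S (\<lambda>t. f t $ n)"
  shows "continuous_on S (\<lambda>t. (f t ^ k) $ n)"
proof (induction k arbitrary: n)
  case 0
  show ?case by simp
next
  case (Suc k)
  show ?case
    unfolding power_Suc by (intro continuous_on_fps_nth_mult assms Suc.IH)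
qed

lemma continuous_on_fps_nth_compose:
  fixes f g :: "'a::topological_space \<Rightarrow> 'b::real_normed_algebra_1 fps"
  assumes "\<And>n. continuous_on S (\<lambda>t. f t $ n)" "\<And>n. continuous_on S (\<lambda>t. g t $ n)"
  shows "continuous_on S (\<lambda>t. (f t oo g t) $ n)"
  unfolding fps_compose_nth
  by (intro continuous_intros continuous_on_fps_nth_power assms)

text \<open>Strong induction along the recursion that defines \<open>compinv\<close>: each new
  coefficient uses only earlier ones and coefficients of powers of \<open>f t\<close>.\<close>

lemma continuous_on_fps_nth_inv:
  fixes f :: "'a::topological_space \<Rightarrow> 'b::real_normed_field fps"
  assumes cont: "\<And>n. continuous_on S (\<lambda>t. f t $ n)"
    and nz: "\<And>t. t \<in> S \<Longrightarrow> f t $ 1 \<noteq> 0"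
  shows "continuous_on S (\<lambda>t. fps_inv (f t) $ n)"
proof (induction n rule: less_induct)
  case (less n)
  show ?case
  proof (cases n)
    case 0
    then show ?thesis by (simp add: fps_inv_def)
  next
    case (Suc m)
    have IH: "continuous_on S (\<lambda>t. compinv (f t) i)" if "i \<in> {0..m}" for i
      using less[of i] that Suc by (simp add: fps_inv_def)
    \<comment> \<open>This is the recursion unfolded once; \<open>nz\<close> keeps the denominator
      away from zero.\<close>
    have "continuous_on S (\<lambda>t. (fps_X $ Suc m - (\<Sum>i=0..m. compinv (f t) i * (f t ^ i) $ Suc m))
            / (f t $ 1) ^ Suc m)"
      by (intro continuous_intros IH continuous_on_fps_nth_power cont ballI)
        (use nz in \<open>simp_all add: cont\<close>)
    then show ?thesis
      unfolding Suc by (simp add: fps_inv_def)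
  qed
qed

lemma fps_inv_nth_0 [simp]: "fps_inv f $ 0 = 0"
  by (simp add: fps_inv_def)

lemma fps_inv_fps_X: "fps_inv fps_X = fps_X"
  using fps_inv[of fps_X] by simp

lemma fps_log_nth_0 [simp]: "fps_log A $ 0 = 0"
  by (simp add: fps_log_def)

lemma fps_cpow_nth_0 [simp]: "fps_cpow A \<tau> $ 0 = 1"
  by (simp add: fps_cpow_def)

lemma fps_cpow_0: "fps_cpow A 0 = 1"
  by (simp add: fps_cpow_def)

text \<open>The series \<open>fps_ln 1\<close> is the compositional inverse of
  \<open>fps_exp 1 - 1\<close>; the constant is subtracted because only a series without constant
  term can be inverted this way.\<close>

lemma fps_exp_compose_ln: "fps_exp 1 oo fps_ln 1 = 1 + (fps_X :: 'a::field_char_0 fps)"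
proof -
  have "(fps_exp 1 - 1) oo fps_ln (1::'a) = fps_X"
    using fps_inv_fps_exp_compose(2)[of "1::'a"] by (simp add: fps_ln_fps_exp_inv)
  then show ?thesis
    by (simp add: fps_compose_sub_distrib algebra_simps)
qed

lemma fps_cpow_1:
  fixes A :: "complex fps"
  assumes "A $ 0 = 1"
  shows "fps_cpow A 1 = A"
proof -
  \<comment> \<open>Reassociating the composition is sound since \<open>fps_ln 1\<close> and
    \<open>A - 1\<close> have zero constant term.\<close>
  have "fps_cpow A 1 = fps_exp 1 oo fps_ln 1 oo (A - 1)"
    using assms by (simp add: fps_cpow_def fps_log_def fps_compose_assoc)
  also have "\<dots> = A"
    using assms by (simp add: fps_exp_compose_ln fps_compose_add_distrib)
  finally show ?thesis .
qed

lemma continuous_on_fps_cpow_nth: "continuous_on S (\<lambda>t. fps_cpow A (complex_of_real t) $ n)"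
  unfolding fps_cpow_def
  by (intro continuous_on_fps_nth_compose) (auto intro!: continuous_intros)

lemma fps_X_divide_compose_fps_inv:
  fixes A :: "'a::field fps"
  assumes "A $ 0 \<noteq> 0"
  shows "fps_X / (A oo fps_inv (fps_X * A)) = fps_inv (fps_X * A)"
proof -
  let ?g = "fps_inv (fps_X * A)"
  \<comment> \<open>The linear coefficient of \<open>fps_X * A\<close> is \<open>A $ 0\<close>, so
    \<open>?g\<close> is a genuine compositional inverse.\<close>
  have "fps_X = (fps_X * A) oo ?g"
    using assms by (simp add: fps_inv_right)
  also have "\<dots> = ?g * (A oo ?g)"
    by (simp add: fps_compose_mult_distrib)
  finally have X: "fps_X = ?g * (A oo ?g)" .
  have "A oo ?g \<noteq> 0"
    using assms by (metis fps_compose_nth_0 fps_zero_nth)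
  then have "(?g * (A oo ?g)) / (A oo ?g) = ?g"
    by simp
  then show ?thesis
    using X by simp
qed

theorem mainTheorem4:
  fixes A :: "complex fps" and F :: "real \<Rightarrow> complex fps"
  assumes A: "A \<in> fps_one_plus"
    and F: "\<And>\<tau>. \<tau> \<in> {0..1} \<Longrightarrow>
              F \<tau> = inverse (A oo fps_inv (fps_X * fps_cpow A (complex_of_real \<tau>)))"
  shows "pathin (subtopology fps_coeff_topology fps_one_plus) F
       \<and> F 0 = inverse A
       \<and> fps_X * F 1 = fps_X / (A oo fps_inv (fps_X * A))
       \<and> fps_X / (A oo fps_inv (fps_X * A)) = fps_inv (fps_X * A)"
proof (intro conjI)
  have A0: "A $ 0 = 1"
    using A by (simp add: fps_one_plus_def)
  let ?g = "\<lambda>t. fps_inv (fps_X * fps_cpow A (complex_of_real t))"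
  have "continuous_on {0..1} (\<lambda>t. F t $ n)" for n
  proof -
    have "continuous_on {0..1} (\<lambda>t. (inverse A oo ?g t) $ n)"
      \<comment> \<open>The goal left to \<open>simp\<close> is that the linear coefficient of the
        inverted series, which is \<open>fps_cpow A t $ 0 = 1\<close>, does not vanish.\<close>
      by (intro continuous_on_fps_nth_compose continuous_on_fps_nth_inv continuous_on_fps_nth_mult
            continuous_on_fps_cpow_nth continuous_on_const) simp
    then show ?thesis
      by (rule continuous_on_eq) (simp add: A0 F fps_inverse_compose)
  qed
  moreover have "F t \<in> fps_one_plus" if "t \<in> {0..1}" for t
    using that A0 by (simp add: F fps_one_plus_def)
  ultimately show "pathin (subtopology fps_coeff_topology fps_one_plus) F"
    by (simp add: pathin_subtopology) (simp add: pathin_def continuous_map_fps_coeff_topology)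
  show "F 0 = inverse A"
    by (simp add: F fps_cpow_0 fps_inv_fps_X)
  show "fps_X * F 1 = fps_X / (A oo fps_inv (fps_X * A))"
    \<comment> \<open>The divisor has constant term 1, so it is a unit and division is
      multiplication by its \<open>inverse\<close>.\<close>
    using A0 by (simp add: F fps_cpow_1 fps_divide_unit)
  show "fps_X / (A oo fps_inv (fps_X * A)) = fps_inv (fps_X * A)"
    using A0 by (simp add: fps_X_divide_compose_fps_inv)
qed

end
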